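(* Let $D$ be a division ring and let $a,b,c$ be elements of $D$ satisfying the following conditions: (a) $abc = cab$; (b) $c(a+b) = (a+b)c$; (c) every zero in $D$ of the polynomial $(x-a)(x-b) \in D[x]$ does not commute with $c$. Then the left ideal $M$ of $D[x,y]$ generated by $(x-a)(x-b)$ and $y-c$ is a maximal left ideal of $D[x,y]$, and its intersection $M \cap D[x]$ is not a maximal left ideal of $D[x]$.
   Context: For a division ring $D$ (not necessarily commutative), $D[x]$ and $D[x,y]$ denote the rings of polynomials over $D$ in one, respectively two, central variables (the variables commute with each other and with all elements of $D$); $D[x]$ is regarded as a subring of $D[x,y]$. For $f = f_nx^n+\ldots+f_1x+f_0 \in D[x]$ (coefficients written on the left) and $v \in D$, put $f(v) = f_nv^n+\ldots+f_1v+f_0$. An element $v\in D$ is called a zero of $f$ if $f(v)=0$. In particular, $(x-a)(x-b)$ is the polynomial $x^2-(a+b)x+ab$, so $v$ is a zero of it if and only if $v^2-(a+b)v+ab=0$. *)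

theory Defs
  imports "HOL.Hull" "HOL-Library.Poly_Mapping" "HOL-Library.Product_Plus"
begin

text \<open>
  Polynomials over a not necessarily commutative ring in one or two central variables are finitely
  supported functions on the exponents. The product on \<^typ>\<open>'a \<Rightarrow>\<^sub>0 'b\<close> is convolution,
  with coefficients multiplied in the given order, so the variables commute with each other and
  with all coefficients.
\<close>

type_synonym 'a poly1 = "nat \<Rightarrow>\<^sub>0 'a"
type_synonym 'a poly2 = "(nat \<times> nat) \<Rightarrow>\<^sub>0 'a"

definition const1 :: "'a::zero \<Rightarrow> 'a poly1" where
  "const1 a = Poly_Mapping.single 0 a"

definition var_x :: "'a::zero_neq_one poly1" where
  "var_x = Poly_Mapping.single 1 1"

definition const2 :: "'a::zero \<Rightarrow> 'a poly2" where
  "const2 a = Poly_Mapping.single (0, 0) a"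

definition var_y :: "'a::zero_neq_one poly2" where
  "var_y = Poly_Mapping.single (0, 1) 1"

text \<open>Coefficients stand to the left of the powers of the point.\<close>

definition eval1 :: "'a::semiring_1 poly1 \<Rightarrow> 'a \<Rightarrow> 'a" where
  "eval1 f v = (\<Sum>i\<in>Poly_Mapping.keys f. Poly_Mapping.lookup f i * v ^ i)"

definition embed_x :: "'a::comm_monoid_add poly1 \<Rightarrow> 'a poly2" where
  "embed_x f = (\<Sum>i\<in>Poly_Mapping.keys f. Poly_Mapping.single (i, 0) (Poly_Mapping.lookup f i))"

text \<open>The subring $D[x]$ of $D[x,y]$.\<close>

definition poly_x :: "'a::comm_monoid_add poly2 set" where
  "poly_x = range embed_x"

text \<open>Left ideals of a unital subring \<open>S\<close> of a ring; \<open>S = UNIV\<close> gives the ring itself.\<close>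

definition left_ideal :: "'r::ring_1 set \<Rightarrow> 'r set \<Rightarrow> bool" where
  "left_ideal S I \<longleftrightarrow> I \<subseteq> S \<and> 0 \<in> I \<and> (\<forall>p\<in>I. \<forall>q\<in>I. p + q \<in> I) \<and> (\<forall>p\<in>I. - p \<in> I)
     \<and> (\<forall>r\<in>S. \<forall>p\<in>I. r * p \<in> I)"

definition maximal_left_ideal :: "'r::ring_1 set \<Rightarrow> 'r set \<Rightarrow> bool" where
  "maximal_left_ideal S I \<longleftrightarrow> left_ideal S I \<and> I \<noteq> S
     \<and> (\<forall>J. left_ideal S J \<and> I \<subseteq> J \<longrightarrow> J = I \<or> J = S)"

definition gen_left_ideal :: "'r::ring_1 set \<Rightarrow> 'r set \<Rightarrow> 'r set" where
  "gen_left_ideal S G = left_ideal S hull G"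

lemma left_ideal_Inter:
  assumes "F \<noteq> {}" "\<And>I. I \<in> F \<Longrightarrow> left_ideal S I"
  shows "left_ideal S (\<Inter>F)"
proof -
  have I: "I \<subseteq> S" "0 \<in> I" "\<And>p q. p \<in> I \<Longrightarrow> q \<in> I \<Longrightarrow> p + q \<in> I"
      "\<And>p. p \<in> I \<Longrightarrow> - p \<in> I" "\<And>r p. r \<in> S \<Longrightarrow> p \<in> I \<Longrightarrow> r * p \<in> I" if "I \<in> F" for I
    using assms(2)[OF that] by (simp_all add: left_ideal_def)
  have "\<Inter>F \<subseteq> S"
    using assms(1) I(1) by (meson Inter_subset)
  with I show ?thesis
    by (simp add: left_ideal_def)
qed

lemma left_ideal_gen_left_ideal:
  assumes "G \<subseteq> S" "left_ideal S S"
  shows "left_ideal S (gen_left_ideal S G)"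
  unfolding gen_left_ideal_def hull_def
  by (rule left_ideal_Inter) (use assms in auto)

lemma lookup_embed_x:
  "Poly_Mapping.lookup (embed_x f) (i, j) = (if j = 0 then Poly_Mapping.lookup f i else 0)"
proof -
  have "Poly_Mapping.lookup (embed_x f) (i, j)
      = (\<Sum>k\<in>Poly_Mapping.keys f. if k = i then (if j = 0 then Poly_Mapping.lookup f k else 0) else 0)"
    by (auto simp: embed_x_def lookup_sum lookup_single when_def intro!: sum.cong)
  also have "\<dots> = (if i \<in> Poly_Mapping.keys f
      then (if j = 0 then Poly_Mapping.lookup f i else 0) else 0)"
    by (rule sum.delta) simp
  finally show ?thesis by (auto simp: in_keys_iff)
qed

lemma inj_embed_x: "inj embed_x"
  by (rule injI, rule poly_mapping_eqI) (metis lookup_embed_x)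

lemma embed_x_add: "embed_x (f + g) = embed_x f + embed_x g"
  by (rule poly_mapping_eqI) (auto simp: lookup_add lookup_embed_x)

lemma embed_x_single: "embed_x (Poly_Mapping.single i a) = Poly_Mapping.single (i, 0) a"
  by (simp add: embed_x_def)

lemma embed_x_one: "embed_x (1 :: 'a::ring_1 poly1) = 1"
  using embed_x_single[of 0 "1::'a"] by (simp add: zero_prod_def[symmetric])

lemma embed_x_sum: "embed_x (\<Sum>i\<in>A. f i) = (\<Sum>i\<in>A. embed_x (f i))"
  by (induction A rule: infinite_finite_induct) (auto simp: embed_x_add, auto simp: embed_x_def)

lemma poly1_sum_single:
  "f = (\<Sum>i\<in>Poly_Mapping.keys f. Poly_Mapping.single i (Poly_Mapping.lookup f i))"
  by (rule poly_mapping_eqI)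
     (auto simp: lookup_sum lookup_single when_def in_keys_iff sum.delta)

lemma embed_x_mult: "embed_x (f * g :: 'a::ring_1 poly1) = embed_x f * embed_x g"
proof -
  let ?s = "\<lambda>h i. Poly_Mapping.single i (Poly_Mapping.lookup h i)"
  have "f * g = (\<Sum>i\<in>Poly_Mapping.keys f. ?s f i) * (\<Sum>j\<in>Poly_Mapping.keys g. ?s g j)"
    by (simp only: poly1_sum_single[symmetric])
  then have "embed_x (f * g) = (\<Sum>i\<in>Poly_Mapping.keys f. \<Sum>j\<in>Poly_Mapping.keys g.
      embed_x (?s f i * ?s g j))"
    by (simp add: sum_product embed_x_sum)
  also have "\<dots> = embed_x f * embed_x g"
    by (simp add: embed_x_def[of f] embed_x_def[of g] sum_product mult_single embed_x_single)
  finally show ?thesis .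
qed

lemma left_ideal_Int_poly_x:
  fixes M :: "'a::ring_1 poly2 set"
  assumes "left_ideal UNIV M"
  shows "left_ideal poly_x (M \<inter> poly_x)"
proof -
  have 0: "0 \<in> (poly_x :: 'a poly2 set)"
    unfolding poly_x_def by (rule range_eqI[of _ _ 0]) (simp add: embed_x_def)
  have add: "p + q \<in> poly_x" and mult: "p * q \<in> poly_x"
    if "p \<in> poly_x" "q \<in> poly_x" for p q :: "'a poly2"
    using that unfolding poly_x_def by (auto simp flip: embed_x_add embed_x_mult)
  have "embed_x f + embed_x (- f) = 0" for f :: "'a poly1"
    by (simp flip: embed_x_add) (simp add: embed_x_def)
  then have "- p \<in> poly_x" if "p \<in> poly_x" for p :: "'a poly2"
    using that unfolding poly_x_def by (metis (no_types) imageE minus_unique rangeI)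
  with 0 add mult assms show ?thesis unfolding left_ideal_def by auto
qed

lemma monic_quadratic_product:
  fixes a b :: "'a::ring_1"
  shows "(var_x - const1 a) * (var_x - const1 b) = var_x ^ 2 - const1 (a + b) * var_x + const1 (a * b)"
  by (simp add: var_x_def const1_def algebra_simps power2_eq_square mult_single single_add)

lemma eval1_alt:
  assumes "finite A" "Poly_Mapping.keys f \<subseteq> A"
  shows "eval1 f v = (\<Sum>i\<in>A. Poly_Mapping.lookup f i * v ^ i)"
  unfolding eval1_def using assms by (intro sum.mono_neutral_left) (auto simp: in_keys_iff)

lemma eval1_quadratic:
  fixes a b v :: "'a::ring_1"
  shows "eval1 ((var_x - const1 a) * (var_x - const1 b)) v = v ^ 2 - (a + b) * v + a * b"
proof -
  have eq: "(var_x - const1 a) * (var_x - const1 b)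
      = Poly_Mapping.single 2 1 - Poly_Mapping.single 1 (a + b) + Poly_Mapping.single 0 (a * b)"
    unfolding monic_quadratic_product
    by (simp add: var_x_def const1_def power2_eq_square mult_single numeral_2_eq_2)
  show ?thesis unfolding eq
    by (subst eval1_alt[of "{0, 1, 2}"])
       (auto simp: in_keys_iff lookup_add lookup_minus lookup_single when_def
             split: if_splits, simp_all add: algebra_simps)
qed

end

theory Submission
  imports Defs
begin

text \<open>
  Write $q = (x-a)(x-b) = x^2 - sx + t$ with $s = a+b$ and $t = ab$. One zero of $q$ is $b$; by
  (c) it does not commute with $c$, so $c \neq 0$. Conditions (a) and (b) say that $c$ commutes with
  $t$ and $s$, so conjugation by $c$ permutes the zeros of $q$ in $D$, and $cbc^{-1}$ is a second one.

  The ideal $M$ is proper because it vanishes at the zeros of $q$ in the following sense. For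
  $f = \sum f_{ij} x^i y^j$ and $v \in D$ put $E_v(f) = \sum f_{ij} c^j v^i$. This evaluation
  turns multiplication of $f$ by $y$ into a passage from $v$ to its conjugate:
  $E_v(yf) = E_{cvc^{-1}}(f)\,c$. Hence the polynomials with $E_v(f) = 0$ for all zeros $v$ of $q$
  form a left ideal, which contains both generators of $M$ but not $1$
  (\<open>left_ideal_eval_twisted_zero\<close>).

  The ideal $M$ is maximal because every $f$ is congruent modulo $M$ to some $ux + w$ with
  $u, w \in D$ (\<open>linear_remainder\<close>). A strictly larger left ideal $J$ therefore contains a nonzero
  constant or some $x - v$. In the second case it contains the constants $q(v)$ and $cv - vc$
  (\<open>eval1_const_if_linear_mem\<close>, \<open>commutator_const_if_linear_mem\<close>), and by (c) these do not both
  vanish. So $J$ is the whole ring.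

  Finally, the elements of $M \cap D[x]$ vanish at $b$ and at $cbc^{-1}$. They form a proper part of
  the left ideal of those polynomials in $D[x]$ that vanish at $b$, since $x - b$ does not vanish at
  $cbc^{-1} \neq b$; and this left ideal does not contain $1$.
\<close>

section \<open>Evaluation of $D[x,y]$ at a point of $D$\<close>

lemma poly_mapping_add_induct [case_names single add]:
  fixes f :: "'k \<Rightarrow>\<^sub>0 'b::comm_monoid_add"
  assumes single: "\<And>k a. P (Poly_Mapping.single k a)"
    and add: "\<And>f g. P f \<Longrightarrow> P g \<Longrightarrow> P (f + g)"
  shows "P f"
proof -
  have "P (\<Sum>k\<in>A. Poly_Mapping.single k (Poly_Mapping.lookup f k))" for A
    using single[of _ 0] by (induction A rule: infinite_finite_induct) (auto intro: single add)
  moreover have "f = (\<Sum>k\<in>Poly_Mapping.keys f. Poly_Mapping.single k (Poly_Mapping.lookup f k))"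
    by (rule poly_mapping_eqI) (auto simp: lookup_sum lookup_single when_def in_keys_iff sum.delta)
  ultimately show ?thesis by metis
qed

text \<open>
  The powers of \<open>c\<close> stand to the left of those of \<open>v\<close>. In $D[x,y]/D[x,y](y-c) \cong D[x]$ the
  variable \<open>y\<close> acts as right multiplication by \<open>c\<close>, so $f$ becomes
  $\sum f_{ij} c^j x^i$, and this polynomial in \<open>x\<close> is evaluated at \<open>v\<close>.
\<close>

definition eval_twisted :: "'a::ring_1 \<Rightarrow> 'a \<Rightarrow> 'a poly2 \<Rightarrow> 'a" where
  "eval_twisted c v f = (\<Sum>(i, j)\<in>Poly_Mapping.keys f. Poly_Mapping.lookup f (i, j) * c ^ j * v ^ i)"

lemma eval_twisted_superset:
  assumes "finite A" "Poly_Mapping.keys f \<subseteq> A"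
  shows "eval_twisted c v f = (\<Sum>(i, j)\<in>A. Poly_Mapping.lookup f (i, j) * c ^ j * v ^ i)"
  unfolding eval_twisted_def using assms
  by (intro sum.mono_neutral_left) (auto simp: in_keys_iff)

lemma eval_twisted_single:
  "eval_twisted c v (Poly_Mapping.single (i, j) d) = d * c ^ j * v ^ i"
  by (subst eval_twisted_superset[of "{(i, j)}"]) auto

lemma eval_twisted_zero [simp]: "eval_twisted c v 0 = 0"
  by (simp add: eval_twisted_def)

lemma eval_twisted_add: "eval_twisted c v (f + g) = eval_twisted c v f + eval_twisted c v g"
proof -
  let ?A = "Poly_Mapping.keys f \<union> Poly_Mapping.keys g"
  have "Poly_Mapping.keys (f + g) \<subseteq> ?A" by (rule Poly_Mapping.keys_add)
  then show ?thesis
    by (simp add: eval_twisted_superset[of ?A] lookup_add split_def distrib_right sum.distrib)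
qed

lemma eval_twisted_minus: "eval_twisted c v (- f) = - eval_twisted c v f"
  using eval_twisted_add[of c v f "- f"] by (simp add: eq_neg_iff_add_eq_0 add.commute)

lemma eval_twisted_diff: "eval_twisted c v (f - g) = eval_twisted c v f - eval_twisted c v g"
  using eval_twisted_add[of c v f "- g"] by (simp add: eval_twisted_minus)

lemma eval_twisted_embed_x: "eval_twisted c v (embed_x f) = eval1 f v"
proof -
  have "eval_twisted c v (\<Sum>i\<in>A. g i) = (\<Sum>i\<in>A. eval_twisted c v (g i))"
    for A and g :: "nat \<Rightarrow> 'a poly2"
    by (induction A rule: infinite_finite_induct) (auto simp: eval_twisted_add)
  then show ?thesis
    by (simp add: embed_x_def eval1_def eval_twisted_single)
qed

text \<open>
  Moving $c^j$ past the powers of \<open>v\<close> replaces \<open>v\<close> by \<open>w\<close>. The relation $c^j v = w c^j$ stands in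
  place of $w = c^j v c^{-j}$, so that \<open>c\<close> may be a non-unit.
\<close>

lemma eval_twisted_monomial_mult:
  assumes "c ^ j * v = w * c ^ j"
  shows "eval_twisted c v (Poly_Mapping.single (i, j) d * f) = d * eval_twisted c w f * c ^ j * v ^ i"
proof (induction f rule: poly_mapping_add_induct)
  case (single t e)
  obtain k l where t: "t = (k, l)" by fastforce
  have pow: "c ^ j * v ^ k = w ^ k * c ^ j"
  proof (induction k)
    case (Suc k)
    have "c ^ j * v ^ Suc k = c ^ j * v ^ k * v"
      by (simp add: power_Suc2 mult.assoc del: power_Suc)
    also have "\<dots> = w ^ k * (c ^ j * v)" by (simp add: Suc mult.assoc)
    also have "\<dots> = w ^ Suc k * c ^ j"
      by (simp add: assms power_Suc2 mult.assoc del: power_Suc)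
    finally show ?case .
  qed simp
  have "d * e * c ^ (j + l) * v ^ (i + k) = d * e * c ^ l * (c ^ j * v ^ k) * v ^ i"
    by (simp add: add.commute[of j l] add.commute[of i k] power_add mult.assoc)
  then show ?case
    by (simp add: t mult_single eval_twisted_single pow mult.assoc)
next
  case (add f g)
  then show ?case by (simp add: distrib_left distrib_right eval_twisted_add)
qed

text \<open>
  Multiplying \<open>p\<close> by a monomial of degree $j$ in \<open>y\<close> turns the value at \<open>v\<close> into a multiple of the
  value of \<open>p\<close> at the $j$-fold conjugate of \<open>v\<close>, which again lies in \<open>Z\<close>. The choice $c = 1$ allows every set \<open>Z\<close>.
\<close>

lemma left_ideal_eval_twisted_zero:
  fixes c :: "'a::ring_1"
  assumes conj: "\<And>v. v \<in> Z \<Longrightarrow> \<exists>w\<in>Z. c * v = w * c"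
  shows "left_ideal UNIV {f. \<forall>v\<in>Z. eval_twisted c v f = 0}"
proof -
  have conj_pow: "\<exists>w\<in>Z. c ^ j * v = w * c ^ j" if "v \<in> Z" for v j
  proof (induction j)
    case 0
    with that show ?case by auto
  next
    case (Suc j)
    then obtain w where w: "w \<in> Z" "c ^ j * v = w * c ^ j" by auto
    with conj obtain w' where w': "w' \<in> Z" "c * w = w' * c" by blast
    have "c ^ Suc j * v = c * w * c ^ j" by (simp add: w mult.assoc)
    also have "\<dots> = w' * c ^ Suc j" by (simp add: w' mult.assoc)
    finally show ?case using w' by blast
  qed
  have "eval_twisted c v (r * p) = 0"
    if p: "\<forall>v\<in>Z. eval_twisted c v p = 0" and v: "v \<in> Z" for r p v
  proof (induction r rule: poly_mapping_add_induct)
    case (single t d)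
    obtain i j where t: "t = (i, j)" by fastforce
    from conj_pow[OF v] obtain w where "w \<in> Z" "c ^ j * v = w * c ^ j" by blast
    with p show ?case by (simp add: t eval_twisted_monomial_mult)
  next
    case (add f g)
    then show ?case by (simp add: distrib_right eval_twisted_add)
  qed
  then show ?thesis
    by (auto simp: left_ideal_def eval_twisted_add eval_twisted_minus)
qed

section \<open>Reduction modulo a left ideal of $D[x,y]$\<close>

lemma left_idealD:
  assumes "left_ideal UNIV I"
  shows "0 \<in> I" "p \<in> I \<Longrightarrow> q \<in> I \<Longrightarrow> p + q \<in> I" "p \<in> I \<Longrightarrow> q \<in> I \<Longrightarrow> p - q \<in> I"
    "p \<in> I \<Longrightarrow> r * p \<in> I"
proof -
  show "p \<in> I \<Longrightarrow> q \<in> I \<Longrightarrow> p - q \<in> I"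
    using assms unfolding left_ideal_def by (metis diff_conv_add_uminus)
qed (use assms in \<open>auto simp: left_ideal_def\<close>)

lemma left_ideal_const_eq_UNIV:
  fixes d :: "'a::division_ring"
  assumes "left_ideal UNIV J" "const2 d \<in> J" "d \<noteq> 0"
  shows "J = UNIV"
proof -
  have "const2 (inverse d) * const2 d = 1"
    using assms(3) by (simp add: const2_def mult_single flip: zero_prod_def)
  then have "1 \<in> J" using left_idealD(4)[OF assms(1,2)] by metis
  then have "r * 1 \<in> J" for r by (rule left_idealD(4)[OF assms(1)])
  then show ?thesis by auto
qed

lemma embed_x_diff: "embed_x (f - g :: 'a::ring_1 poly1) = embed_x f - embed_x g"
  using embed_x_add[of "f - g" g] by simp

lemma embed_x_quadratic:
  fixes a b :: "'a::ring_1"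
  shows "embed_x ((var_x - const1 a) * (var_x - const1 b))
    = Poly_Mapping.single (2, 0) 1 - Poly_Mapping.single (1, 0) (a + b) + const2 (a * b)"
proof -
  have eq: "(var_x - const1 a) * (var_x - const1 b)
      = Poly_Mapping.single 2 1 - Poly_Mapping.single 1 (a + b) + Poly_Mapping.single 0 (a * b)"
    unfolding monic_quadratic_product
    by (simp add: var_x_def const1_def power2_eq_square mult_single numeral_2_eq_2)
  show ?thesis
    unfolding eq
    by (simp only: embed_x_add embed_x_diff embed_x_single const2_def)
qed

text \<open>
  Modulo $y - c$ a factor \<open>y\<close> at the right end of a monomial can be replaced by \<open>c\<close>, and modulo the
  quadratic polynomial the power $x^{k+2}$ by $(a+b)x^{k+1} - abx^k$. This lowers the degree in \<open>y\<close>
  to \<open>0\<close> and then the degree in \<open>x\<close> to at most \<open>1\<close>.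
\<close>

lemma linear_remainder:
  fixes a b c :: "'a::ring_1"
  assumes M: "left_ideal UNIV M"
    and q: "embed_x ((var_x - const1 a) * (var_x - const1 b)) \<in> M"
    and y: "var_y - const2 c \<in> M"
  shows "\<exists>u w. f - (Poly_Mapping.single (1, 0) u + const2 w) \<in> M"
proof -
  let ?R = "\<lambda>f. \<exists>u w. f - (Poly_Mapping.single (1, 0) u + const2 w) \<in> M"
  have R_add: "?R (f + g)" if "?R f" "?R g" for f g
  proof -
    from that obtain u w u' w' where
      "f - (Poly_Mapping.single (1, 0) u + const2 w) \<in> M"
      "g - (Poly_Mapping.single (1, 0) u' + const2 w') \<in> M" by blast
    from left_idealD(2)[OF M this]
    have "f + g - (Poly_Mapping.single (1, 0) (u + u') + const2 (w + w')) \<in> M"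
      by (simp add: single_add const2_def algebra_simps)
    then show ?thesis by blast
  qed
  have R_M: "?R f" if "f \<in> M" for f
    using that by (intro exI[of _ 0]) (simp add: const2_def)
  have x_power: "?R (Poly_Mapping.single (i, 0) d)" for i d
  proof (induction i arbitrary: d rule: less_induct)
    case (less i)
    consider "i = 0" | "i = 1" | k where "i = k + 2"
      by (metis One_nat_def add_2_eq_Suc' not0_implies_Suc)
    then show ?case
    proof cases
      case 1
      then show ?thesis by (intro exI[of _ 0] exI[of _ d]) (simp add: const2_def left_idealD(1)[OF M])
    next
      case 2
      then show ?thesis by (intro exI[of _ d] exI[of _ 0]) (simp add: const2_def left_idealD(1)[OF M])
    next
      case 3
      let ?q = "embed_x ((var_x - const1 a) * (var_x - const1 b))"
      have "Poly_Mapping.single (i, 0) d = Poly_Mapping.single (k, 0) d * ?q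
          + Poly_Mapping.single (k + 1, 0) (d * (a + b)) + Poly_Mapping.single (k, 0) (- (d * (a * b)))"
        unfolding embed_x_quadratic
        by (simp add: 3 const2_def distrib_left right_diff_distrib mult_single single_uminus single_add)
      moreover have "?R (Poly_Mapping.single (k, 0) d * ?q
          + Poly_Mapping.single (k + 1, 0) (d * (a + b)) + Poly_Mapping.single (k, 0) (- (d * (a * b))))"
        by (intro R_add less R_M left_idealD(4)[OF M q]) (simp_all add: 3)
      ultimately show ?thesis by simp
    qed
  qed
  have monomial: "?R (Poly_Mapping.single (i, j) d)" for i j d
  proof (induction j arbitrary: d)
    case (Suc j)
    have "Poly_Mapping.single (i, Suc j) d
        = Poly_Mapping.single (i, j) d * (var_y - const2 c) + Poly_Mapping.single (i, j) (d * c)"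
      by (simp add: var_y_def const2_def right_diff_distrib mult_single)
    then show ?case using R_add[OF R_M[OF left_idealD(4)[OF M y]] Suc] by metis
  qed (rule x_power)
  show ?thesis
  proof (induction f rule: poly_mapping_add_induct)
    case (single t d)
    show ?case using monomial by (cases t) simp
  qed (rule R_add)
qed

text \<open>
  The value at \<open>v\<close> is the remainder of right division by $x - v$; the quotient here is
  $x - (a + b - v)$.
\<close>

lemma eval1_const_if_linear_mem:
  fixes a b v :: "'a::ring_1"
  assumes J: "left_ideal UNIV J"
    and q: "embed_x ((var_x - const1 a) * (var_x - const1 b)) \<in> J"
    and lin: "Poly_Mapping.single (1, 0) 1 - const2 v \<in> J"
  shows "const2 (eval1 ((var_x - const1 a) * (var_x - const1 b)) v) \<in> J"
proof -
  have "const2 (eval1 ((var_x - const1 a) * (var_x - const1 b)) v)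
    = embed_x ((var_x - const1 a) * (var_x - const1 b))
      - (Poly_Mapping.single (1, 0) 1 - const2 (a + b - v)) * (Poly_Mapping.single (1, 0) 1 - const2 v)"
    unfolding eval1_quadratic embed_x_quadratic
    by (simp add: const2_def algebra_simps mult_single power2_eq_square single_add single_diff numeral_2_eq_2)
  then show ?thesis
    using left_idealD(3)[OF J q left_idealD(4)[OF J lin]] by metis
qed

text \<open>
  Modulo $y - c$ the element $y(x-v) = (x-v)y$ is $(x-v)c = cx - vc$, and subtracting $c(x-v)$
  removes the term in \<open>x\<close>.
\<close>

lemma commutator_const_if_linear_mem:
  fixes c v :: "'a::ring_1"
  assumes J: "left_ideal UNIV J"
    and y: "var_y - const2 c \<in> J"
    and lin: "Poly_Mapping.single (1, 0) 1 - const2 v \<in> J"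
  shows "const2 (c * v - v * c) \<in> J"
proof -
  let ?l = "Poly_Mapping.single (1, 0) 1 - const2 v"
  have "const2 (c * v - v * c) = var_y * ?l - ?l * (var_y - const2 c) - const2 c * ?l"
    by (simp add: var_y_def const2_def algebra_simps mult_single single_diff)
  then show ?thesis
    using left_idealD(3,4)[OF J] y lin by metis
qed

section \<open>The left ideal generated by $(x-a)(x-b)$ and $y-c$\<close>

text \<open>
  For invertible \<open>c\<close> this says that conjugation by \<open>c\<close> maps zeros of $x^2 - sx + t$ to zeros, because
  it fixes the coefficients.
\<close>

lemma quadratic_intertwine:
  fixes c s t v w :: "'a::ring_1"
  assumes "c * s = s * c" "c * t = t * c" "c * v = w * c"
  shows "c * (v ^ 2 - s * v + t) = (w ^ 2 - s * w + t) * c"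
proof -
  have "c * v ^ 2 = c * v * v" by (simp add: power2_eq_square mult.assoc)
  also have "\<dots> = w * (c * v)" by (simp add: assms(3) mult.assoc)
  also have "\<dots> = w ^ 2 * c" by (simp add: assms(3) power2_eq_square mult.assoc)
  finally have "c * v ^ 2 = w ^ 2 * c" .
  moreover have "c * (s * v) = s * w * c"
    unfolding mult.assoc[symmetric] assms(1) by (simp add: assms(3) mult.assoc)
  ultimately show ?thesis
    by (simp only: distrib_left distrib_right left_diff_distrib right_diff_distrib assms(2))
qed

theorem proposition2p3:
  fixes a b c :: "'a::division_ring" and M :: "'a poly2 set"
  assumes "a * b * c = c * a * b"
    and "c * (a + b) = (a + b) * c"
    and "\<And>v. eval1 ((var_x - const1 a) * (var_x - const1 b)) v = 0 \<Longrightarrow> v * c \<noteq> c * v"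
  defines "M \<equiv> gen_left_ideal UNIV
      {embed_x ((var_x - const1 a) * (var_x - const1 b)), var_y - const2 c}"
  shows "maximal_left_ideal UNIV M \<and> \<not> maximal_left_ideal poly_x (M \<inter> poly_x)"
proof -
  define q where "q = (var_x - const1 a) * (var_x - const1 b)"
  define Z where "Z = {v. eval1 q v = 0}"
  have M: "left_ideal UNIV M"
    unfolding M_def by (rule left_ideal_gen_left_ideal) (auto simp: left_ideal_def)
  have q: "embed_x q \<in> M" and y: "var_y - const2 c \<in> M"
    unfolding M_def gen_left_ideal_def q_def by (auto intro: hull_inc)
  \<comment> \<open>Since $b^2 - (a+b)b + ab = 0$: a zero of the right factor is a zero of the product.\<close>
  have b: "b \<in> Z"
    unfolding Z_def q_def mem_Collect_eq eval1_quadratic by (simp add: power2_eq_square algebra_simps)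
  then have bc: "b * c \<noteq> c * b" using assms(3) by (simp add: Z_def q_def)
  then have c: "c \<noteq> 0" by auto
  have conj: "\<exists>w\<in>Z. c * v = w * c" if "v \<in> Z" for v
  proof
    let ?w = "c * v * inverse c"
    show wc: "c * v = ?w * c" using c by (simp add: mult.assoc)
    have "c * (a * b) = a * b * c" using assms(1) by (simp add: mult.assoc)
    from quadratic_intertwine[OF assms(2) this wc]
    have "(?w ^ 2 - (a + b) * ?w + a * b) * c = c * (v ^ 2 - (a + b) * v + a * b)" ..
    also have "\<dots> = 0" using that by (simp only: Z_def q_def eval1_quadratic mem_Collect_eq mult_zero_right)
    finally show "?w \<in> Z" using c by (simp only: Z_def q_def eval1_quadratic mem_Collect_eq mult_eq_0_iff simp_thms)
  qed
  let ?K = "{f. \<forall>v\<in>Z. eval_twisted c v f = 0}"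
  have "M \<subseteq> ?K"
    unfolding M_def gen_left_ideal_def
  proof (rule hull_minimal)
    show "left_ideal UNIV ?K" by (rule left_ideal_eval_twisted_zero) (rule conj)
    show "{embed_x ((var_x - const1 a) * (var_x - const1 b)), var_y - const2 c} \<subseteq> ?K"
      by (auto simp: eval_twisted_embed_x eval_twisted_diff eval_twisted_single var_y_def const2_def
          Z_def q_def)
  qed
  then have M_eval: "eval_twisted c v f = 0" if "f \<in> M" "v \<in> Z" for f v using that by blast
  have eval_one: "eval_twisted d v 1 = 1" for d v :: 'a
    using eval_twisted_single[of d v 0 0 1] by (simp flip: zero_prod_def)
  have "maximal_left_ideal UNIV M"
    unfolding maximal_left_ideal_def
  proof (intro conjI allI impI)
    show "M \<noteq> UNIV" using M_eval[OF _ b, of 1] by (auto simp: eval_one)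
    fix J assume "left_ideal UNIV J \<and> M \<subseteq> J"
    then have J: "left_ideal UNIV J" "M \<subseteq> J" by auto
    have "J = UNIV" if "J \<noteq> M"
    proof -
      from that J(2) obtain f where f: "f \<in> J" "f \<notin> M" by blast
      obtain u w where uw: "f - (Poly_Mapping.single (1, 0) u + const2 w) \<in> M"
        using linear_remainder[OF M _ y] q unfolding q_def by blast
      then have r: "Poly_Mapping.single (1, 0) u + const2 w \<in> J"
        using left_idealD(3)[OF J(1) f(1)] J(2) by (metis diff_diff_eq2 add_diff_cancel_left' subsetD)
      show "J = UNIV"
      proof (cases "u = 0")
        case True
        with uw f(2) have "w \<noteq> 0" by (auto simp: const2_def)
        with True r show ?thesis using left_ideal_const_eq_UNIV[OF J(1)] by auto
      next
        case False
        \<comment> \<open>Here $ux + w = u(x - v)$.\<close>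
        define v where "v = - (inverse u * w)"
        have "Poly_Mapping.single (1, 0) 1 - const2 v
            = const2 (inverse u) * (Poly_Mapping.single (1, 0) u + const2 w)"
          using False by (simp add: v_def const2_def distrib_left mult_single single_uminus)
        then have lin: "Poly_Mapping.single (1, 0) 1 - const2 v \<in> J"
          using left_idealD(4)[OF J(1) r] by metis
        show ?thesis
        proof (cases "v \<in> Z")
          case True
          then have "c * v - v * c \<noteq> 0" using assms(3)[of v] by (auto simp: Z_def q_def)
          then show ?thesis
            using left_ideal_const_eq_UNIV commutator_const_if_linear_mem J lin y by blast
        next
          case False
          then have "eval1 q v \<noteq> 0" by (simp add: Z_def)
          then show ?thesis
            using left_ideal_const_eq_UNIV eval1_const_if_linear_mem J lin q unfolding q_def by blast
        qed
      qed
    qed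
    then show "J = M \<or> J = UNIV" by blast
  qed (rule M)
  moreover have "\<not> maximal_left_ideal poly_x (M \<inter> poly_x)"
  proof
    assume max: "maximal_left_ideal poly_x (M \<inter> poly_x)"
    \<comment> \<open>On $D[x]$ the evaluation depends only on the point, so with $1$ in place of $c$ the set
      \<open>{b}\<close> is closed under conjugation and \<open>?N \<inter> poly_x\<close> consists of the $f \<in> D[x]$ with $f(b) = 0$.\<close>
    let ?N = "{f. \<forall>v\<in>{b}. eval_twisted 1 v f = 0}"
    have "left_ideal poly_x (?N \<inter> poly_x)"
      by (intro left_ideal_Int_poly_x left_ideal_eval_twisted_zero) auto
    moreover have "M \<inter> poly_x \<subseteq> ?N \<inter> poly_x"
      using M_eval[OF _ b] by (auto simp: poly_x_def) (metis eval_twisted_embed_x)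
    ultimately consider "?N \<inter> poly_x = M \<inter> poly_x" | "?N \<inter> poly_x = poly_x"
      using max unfolding maximal_left_ideal_def by blast
    then show False
    proof cases
      case 1
      let ?l = "Poly_Mapping.single (1, 0) 1 - const2 b"
      have eval_l: "eval_twisted d v ?l = v - b" for d v
        by (simp add: eval_twisted_diff eval_twisted_single const2_def)
      have "?l = embed_x (var_x - const1 b)"
        by (simp only: embed_x_diff embed_x_single const2_def var_x_def const1_def)
      then have "?l \<in> poly_x" unfolding poly_x_def by (rule range_eqI)
      moreover have "?l \<in> ?N" using eval_l[of 1 b] by simp
      ultimately have "?l \<in> M" using 1 by blast
      obtain w where w: "w \<in> Z" "c * b = w * c" using conj[OF b] by blast
      then have "w = b" using M_eval[OF \<open>?l \<in> M\<close>, of w] unfolding eval_l by simp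
      with w bc show False by simp
    next
      case 2
      have "1 \<in> (poly_x :: 'a poly2 set)" unfolding poly_x_def by (metis embed_x_one rangeI)
      with 2 have "1 \<in> ?N" by blast
      then show False by (simp add: eval_one)
    qed
  qed
  ultimately show ?thesis by blast
qed

end
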